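(* For any integer $p$ there is a shock wave type solution of the Hopf equation $u_t+uu_x=0$ up to $e^{-p}$ in the sense of $\mathbf{R}\langle\varepsilon\rangle$-distributions, i.e. a function $$w(t,x,\varepsilon)=h_0+\Delta h\, K\!\left(\frac{x-at}{\varepsilon}\right),$$ with $h_0,\Delta h,a$ real numbers, $\Delta h\neq0$, $K(x)=\int_{-\infty}^x\theta(y)\,dy$, $\theta\in\mathcal{S}(\mathbf{R})$, $\int_{-\infty}^{+\infty}\theta(y)\,dy=1$, such that for every $t\in[0,T]$ and every $\psi\in\mathcal{S}(\mathbf{R})$, $$\int_{-\infty}^{+\infty}\{w_t(t,x,\varepsilon)+w(t,x,\varepsilon)w_x(t,x,\varepsilon)\}\psi(x)\,dx=\sum_{k=p}^{+\infty}\eta_k\varepsilon^k\in\mathbf{R}\langle\varepsilon\rangle .$$ Moreover, $$\frac{a-h_0}{\Delta h}=\frac12.$$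
   Context: $\mathbf{R}\langle\varepsilon\rangle$ is the field of formal Laurent series $\sum_{n\ge 0}\xi_{n+k}\varepsilon^{n+k}$ ($k\in\mathbf{Z}$, $\xi_i\in\mathbf{R}$) with the non-Archimedean norm $|x|_\nu=e^{-\nu(x)}$, where $\nu(x)$ is the lowest exponent with nonzero coefficient ($\nu(0)=\infty$). An integral depending on $\varepsilon\in(0,1]$ is regarded as an element of $\mathbf{R}\langle\varepsilon\rangle$ via its expansion in powers of $\varepsilon$; "solution up to $e^{-p}$" means this element has the form $\sum_{k\ge p}\eta_k\varepsilon^k$. $T>0$ is a fixed time horizon and $\mathcal{S}(\mathbf{R})$ is the Schwartz space. *)

theory Defs
  imports "HOL-Analysis.Analysis" "HOL-Library.Landau_Symbols"
begin

definition schwartz :: "(real \<Rightarrow> real) \<Rightarrow> bool" where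
  "schwartz f \<longleftrightarrow>
     (\<forall>n x. ((deriv ^^ n) f) differentiable (at x)) \<and>
     (\<forall>m n. \<exists>C. \<forall>x. \<bar>x\<bar> ^ m * \<bar>(deriv ^^ n) f x\<bar> \<le> C)"

definition Kfun :: "(real \<Rightarrow> real) \<Rightarrow> real \<Rightarrow> real" where
  "Kfun \<theta> x = integral {..x} \<theta>"

definition shock_w :: "(real \<Rightarrow> real) \<Rightarrow> real \<Rightarrow> real \<Rightarrow> real \<Rightarrow> real \<Rightarrow> real \<Rightarrow> real \<Rightarrow> real" where
  "shock_w \<theta> h0 dh a t x \<epsilon> = h0 + dh * Kfun \<theta> ((x - a * t) / \<epsilon>)"

text \<open>The element of R<eps> given by the expansion of f in powers of eps
  (as eps \<rightarrow> 0+) has the form sum_{k >= p} eta_k eps^k, i.e. valuation >= p.\<close>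
definition eps_expansion_from :: "(real \<Rightarrow> real) \<Rightarrow> int \<Rightarrow> bool" where
  "eps_expansion_from f p \<longleftrightarrow>
     (\<exists>\<eta> :: int \<Rightarrow> real. \<forall>N::int. N \<ge> p \<longrightarrow>
        (\<lambda>\<epsilon>. f \<epsilon> - (\<Sum>k\<in>{p..N}. \<eta> k * \<epsilon> powi k))
          \<in> O[at_right 0](\<lambda>\<epsilon>. \<epsilon> powi (N + 1)))"

end

theory Submission
  imports Defs "HOL-Probability.Sinc_Integral" "HOL-Computational_Algebra.Polynomial"
begin

text \<open>
  Take \<open>h\<^sub>0 = 0\<close>, \<open>\<Delta>h = 1\<close>, \<open>a = 1/2\<close> and \<open>K = (1 + F)/2\<close> with \<open>F\<close> odd. After the substitution
  \<open>x = t/2 + \<epsilon> y\<close> the integral becomes \<open>\<integral> (K - 1/2) K' (y) \<psi>(t/2 + \<epsilon> y) dy\<close>, where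
  \<open>(K - 1/2) K' = (F\<^sup>2)'/8\<close>; by Taylor expansion of \<open>\<psi>\<close> it has valuation at least \<open>p\<close> as soon as the
  moments of \<open>(F\<^sup>2)'\<close> of order below \<open>p\<close> vanish. So set \<open>F\<^sup>2 = 1 - \<chi>\<close>, where \<open>\<chi>\<close> is the \<open>2m\<close>-th derivative
  of the Gaussian, normalised by \<open>\<chi>(0) = 1\<close>: then \<open>\<chi>'\<close> is orthogonal to all polynomials of degree
  at most \<open>2m\<close>. Since \<open>\<chi>'' + x \<chi>' + (2m + 1) \<chi> = 0\<close>, the energy \<open>\<chi>'\<^sup>2 + (2m + 1) \<chi>\<^sup>2\<close> decreases away
  from \<open>0\<close>, so \<open>\<chi> < 1\<close> off the origin, and \<open>1 - \<chi> = x\<^sup>2 R(x)\<close> with \<open>R\<close> smooth and positive. Hence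
  \<open>F = x \<surd>R\<close> is smooth, tends to \<open>\<plusminus>1\<close> at \<open>\<plusminus>\<infinity>\<close>, and \<open>F'\<close> is a Schwartz function.
\<close>

section \<open>Rapid decrease and polynomial growth\<close>

definition rapidly_decreasing :: "(real \<Rightarrow> real) \<Rightarrow> bool" where
  "rapidly_decreasing f \<longleftrightarrow> (\<forall>m. \<exists>C. \<forall>x. \<bar>x\<bar> ^ m * \<bar>f x\<bar> \<le> C)"

definition polynomially_bounded :: "(real \<Rightarrow> real) \<Rightarrow> bool" where
  "polynomially_bounded f \<longleftrightarrow> (\<exists>C d. \<forall>x. \<bar>f x\<bar> \<le> C * (1 + \<bar>x\<bar>) ^ d)"

text \<open>The derivative is an existential witness rather than \<open>deriv\<close>, so closure
  properties follow by induction from derivative rules without evaluating \<open>deriv\<close>. The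
  parameter \<open>Q\<close> lets one induction serve both rapid decrease and polynomial
  growth.\<close>

primrec derivatives_satisfy :: "((real \<Rightarrow> real) \<Rightarrow> bool) \<Rightarrow> nat \<Rightarrow> (real \<Rightarrow> real) \<Rightarrow> bool" where
  "derivatives_satisfy Q 0 f \<longleftrightarrow> Q f"
| "derivatives_satisfy Q (Suc n) f \<longleftrightarrow>
     Q f \<and> (\<exists>f'. (\<forall>x. (f has_real_derivative f' x) (at x)) \<and> derivatives_satisfy Q n f')"

lemma derivatives_satisfy_Suc_imp:
  "derivatives_satisfy Q (Suc n) f \<Longrightarrow> derivatives_satisfy Q n f"
proof (induction n arbitrary: f)
  case (Suc n)
  then show ?case
    by (metis derivatives_satisfy.simps(2))
qed simp

lemma derivatives_satisfy_add:
  assumes "\<And>f g. Q f \<Longrightarrow> Q g \<Longrightarrow> Q (\<lambda>x. f x + g x)"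
  shows "derivatives_satisfy Q n f \<Longrightarrow> derivatives_satisfy Q n g \<Longrightarrow>
    derivatives_satisfy Q n (\<lambda>x. f x + g x)"
proof (induction n arbitrary: f g)
  case (Suc n)
  then obtain f' g' where
    "\<forall>x. (f has_real_derivative f' x) (at x)" "derivatives_satisfy Q n f'"
    "\<forall>x. (g has_real_derivative g' x) (at x)" "derivatives_satisfy Q n g'"
    by auto
  then show ?case
    using Suc assms by (auto intro!: exI[of _ "\<lambda>x. f' x + g' x"] derivative_eq_intros)
qed (use assms in auto)

text \<open>In the Leibniz rule every term is a derivative of \<open>f\<close> times a derivative of
  \<open>g\<close>, so only products of a \<open>P\<close> by a \<open>Q\<close> occur. Keeping
  \<open>P\<close> and \<open>Q\<close> apart covers a polynomially bounded multiplier of a rapidly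
  decreasing function.\<close>

lemma derivatives_satisfy_mult:
  assumes add: "\<And>f g. Q f \<Longrightarrow> Q g \<Longrightarrow> Q (\<lambda>x. f x + g x)"
    and mult: "\<And>f g. P f \<Longrightarrow> Q g \<Longrightarrow> Q (\<lambda>x. f x * g x)"
  shows "derivatives_satisfy P n f \<Longrightarrow> derivatives_satisfy Q n g \<Longrightarrow>
    derivatives_satisfy Q n (\<lambda>x. f x * g x)"
proof (induction n arbitrary: f g)
  case (Suc n)
  then obtain f' g' where *:
    "\<forall>x. (f has_real_derivative f' x) (at x)" "derivatives_satisfy P n f'"
    "\<forall>x. (g has_real_derivative g' x) (at x)" "derivatives_satisfy Q n g'"
    by auto
  \<comment> \<open>The induction hypothesis is used for both pairs (f, g') and (f', g); the
    undifferentiated factor gives up one order.\<close>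
  have "derivatives_satisfy Q n (\<lambda>x. f x * g' x + f' x * g x)"
    by (intro derivatives_satisfy_add add Suc.IH derivatives_satisfy_Suc_imp[OF Suc.prems(1)]
        derivatives_satisfy_Suc_imp[OF Suc.prems(2)] *)
  moreover have "\<forall>x. ((\<lambda>x. f x * g x) has_real_derivative f x * g' x + f' x * g x) (at x)"
    using * by (auto intro!: derivative_eq_intros)
  moreover have "Q (\<lambda>x. f x * g x)"
    using Suc.prems mult by auto
  ultimately show ?case by auto
qed (use mult in auto)

lemma rapidly_decreasing_add:
  assumes "rapidly_decreasing f" "rapidly_decreasing g"
  shows "rapidly_decreasing (\<lambda>x. f x + g x)"
  unfolding rapidly_decreasing_def
proof
  fix m
  obtain C D where C: "\<And>x. \<bar>x\<bar> ^ m * \<bar>f x\<bar> \<le> C" and D: "\<And>x. \<bar>x\<bar> ^ m * \<bar>g x\<bar> \<le> D"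
    using assms unfolding rapidly_decreasing_def by metis
  have "\<bar>x\<bar> ^ m * \<bar>f x + g x\<bar> \<le> C + D" for x
  proof -
    have "\<bar>x\<bar> ^ m * \<bar>f x + g x\<bar> \<le> \<bar>x\<bar> ^ m * (\<bar>f x\<bar> + \<bar>g x\<bar>)"
      by (intro mult_left_mono) auto
    with C[of x] D[of x] show ?thesis by (simp add: distrib_left)
  qed
  then show "\<exists>C. \<forall>x. \<bar>x\<bar> ^ m * \<bar>f x + g x\<bar> \<le> C" by blast
qed

lemma polynomially_boundedI: "(\<And>x. \<bar>f x\<bar> \<le> C * (1 + \<bar>x\<bar>) ^ d) \<Longrightarrow> polynomially_bounded f"
  unfolding polynomially_bounded_def by blast

lemma polynomially_boundedE:
  assumes "polynomially_bounded f"
  obtains C d where "0 \<le> C" "\<And>x. \<bar>f x\<bar> \<le> C * (1 + \<bar>x\<bar>) ^ d"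
proof -
  obtain C d where C: "\<And>x. \<bar>f x\<bar> \<le> C * (1 + \<bar>x\<bar>) ^ d"
    using assms unfolding polynomially_bounded_def by metis
  moreover have "0 \<le> C"
    using order_trans[OF abs_ge_zero C[of 0]] by simp
  ultimately show ?thesis by (rule that[rotated])
qed

text \<open>1 + |x| is at most twice the larger of 1 and |x|. This splits a polynomial bound into
  the pure powers in which rapid decrease is stated.\<close>

lemma one_plus_power_le: "(1 + \<bar>x::real\<bar>) ^ d \<le> 2 ^ d * (1 + \<bar>x\<bar> ^ d)"
proof (cases "\<bar>x\<bar> \<le> 1")
  case True
  then have "(1 + \<bar>x\<bar>) ^ d \<le> 2 ^ d" by (intro power_mono) auto
  also have "\<dots> \<le> 2 ^ d * (1 + \<bar>x\<bar> ^ d)" by simp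
  finally show ?thesis .
next
  case False
  then have "(1 + \<bar>x\<bar>) ^ d \<le> (2 * \<bar>x\<bar>) ^ d" by (intro power_mono) auto
  then show ?thesis by (simp add: power_mult_distrib distrib_left add_increasing)
qed

lemma rapidly_decreasing_mult:
  assumes "polynomially_bounded f" "rapidly_decreasing g"
  shows "rapidly_decreasing (\<lambda>x. f x * g x)"
  unfolding rapidly_decreasing_def
proof
  fix m
  obtain C d where C: "0 \<le> C" "\<And>x. \<bar>f x\<bar> \<le> C * (1 + \<bar>x\<bar>) ^ d"
    using assms(1) by (rule polynomially_boundedE) blast
  \<comment> \<open>Decay of order m absorbs the summand 1 of the split bound, decay of order d + m
    the summand |x|^d.\<close>
  obtain D E where D: "\<And>x. \<bar>x\<bar> ^ m * \<bar>g x\<bar> \<le> D" and E: "\<And>x. \<bar>x\<bar> ^ (d + m) * \<bar>g x\<bar> \<le> E"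
    using assms(2) unfolding rapidly_decreasing_def by metis
  have "\<bar>x\<bar> ^ m * \<bar>f x * g x\<bar> \<le> (C * 2 ^ d) * (D + E)" for x
  proof -
    have "\<bar>x\<bar> ^ m * \<bar>f x * g x\<bar> = (\<bar>x\<bar> ^ m * \<bar>g x\<bar>) * \<bar>f x\<bar>"
      by (simp add: abs_mult)
    also have "\<dots> \<le> (\<bar>x\<bar> ^ m * \<bar>g x\<bar>) * (C * (1 + \<bar>x\<bar>) ^ d)"
      by (intro mult_left_mono C) auto
    also have "\<dots> \<le> (\<bar>x\<bar> ^ m * \<bar>g x\<bar>) * (C * (2 ^ d * (1 + \<bar>x\<bar> ^ d)))"
      by (intro mult_left_mono one_plus_power_le C) auto
    also have "\<dots> = (C * 2 ^ d) * (\<bar>x\<bar> ^ m * \<bar>g x\<bar> + \<bar>x\<bar> ^ (d + m) * \<bar>g x\<bar>)"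
      by (simp add: algebra_simps power_add)
    also have "\<dots> \<le> (C * 2 ^ d) * (D + E)"
      using C(1) by (intro mult_left_mono add_mono D E) auto
    finally show ?thesis .
  qed
  then show "\<exists>C. \<forall>x. \<bar>x\<bar> ^ m * \<bar>f x * g x\<bar> \<le> C" by blast
qed

lemma polynomially_bounded_mult:
  assumes "polynomially_bounded f" "polynomially_bounded g"
  shows "polynomially_bounded (\<lambda>x. f x * g x)"
proof -
  obtain C d where C: "0 \<le> C" "\<And>x. \<bar>f x\<bar> \<le> C * (1 + \<bar>x\<bar>) ^ d"
    using assms(1) by (rule polynomially_boundedE) blast
  obtain D e where D: "0 \<le> D" "\<And>x. \<bar>g x\<bar> \<le> D * (1 + \<bar>x\<bar>) ^ e"
    using assms(2) by (rule polynomially_boundedE) blast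
  have "\<bar>f x * g x\<bar> \<le> (C * D) * (1 + \<bar>x\<bar>) ^ (d + e)" for x
    using mult_mono[OF C(2)[of x] D(2)[of x]] C(1) by (simp add: abs_mult power_add mult_ac)
  then show ?thesis by (rule polynomially_boundedI)
qed

lemma polynomially_bounded_add:
  assumes "polynomially_bounded f" "polynomially_bounded g"
  shows "polynomially_bounded (\<lambda>x. f x + g x)"
proof -
  obtain C d where C: "0 \<le> C" "\<And>x. \<bar>f x\<bar> \<le> C * (1 + \<bar>x\<bar>) ^ d"
    using assms(1) by (rule polynomially_boundedE) blast
  obtain D e where D: "0 \<le> D" "\<And>x. \<bar>g x\<bar> \<le> D * (1 + \<bar>x\<bar>) ^ e"
    using assms(2) by (rule polynomially_boundedE) blast
  have "\<bar>f x + g x\<bar> \<le> (C + D) * (1 + \<bar>x\<bar>) ^ (d + e)" for x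
  proof -
    have "C * (1 + \<bar>x\<bar>) ^ d \<le> C * (1 + \<bar>x\<bar>) ^ (d + e)"
      using C by (intro mult_left_mono power_increasing) auto
    moreover have "D * (1 + \<bar>x\<bar>) ^ e \<le> D * (1 + \<bar>x\<bar>) ^ (d + e)"
      using D by (intro mult_left_mono power_increasing) auto
    ultimately show ?thesis
      using C(2)[of x] D(2)[of x] abs_triangle_ineq[of "f x" "g x"] unfolding distrib_right by linarith
  qed
  then show ?thesis by (rule polynomially_boundedI)
qed

lemma derivatives_polynomially_bounded_mult:
  "derivatives_satisfy polynomially_bounded n f \<Longrightarrow> derivatives_satisfy polynomially_bounded n g \<Longrightarrow>
    derivatives_satisfy polynomially_bounded n (\<lambda>x. f x * g x)"
  by (rule derivatives_satisfy_mult[OF polynomially_bounded_add polynomially_bounded_mult])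

lemma derivatives_rapidly_decreasing_mult:
  "derivatives_satisfy polynomially_bounded n f \<Longrightarrow> derivatives_satisfy rapidly_decreasing n g \<Longrightarrow>
    derivatives_satisfy rapidly_decreasing n (\<lambda>x. f x * g x)"
  by (rule derivatives_satisfy_mult[OF rapidly_decreasing_add rapidly_decreasing_mult])

text \<open>A derivative at a point is unique, so the witness in \<open>derivatives_satisfy\<close>
  must be \<open>deriv\<close>; the iterates of \<open>deriv\<close> thus inherit differentiability
  and decay.\<close>

lemma schwartzI:
  assumes "\<And>n. derivatives_satisfy rapidly_decreasing n f"
  shows "schwartz f"
proof -
  have deriv: "derivatives_satisfy Q n (deriv g)" if g: "derivatives_satisfy Q (Suc n) g" for Q n g
  proof -
    obtain g' where g': "\<forall>x. (g has_real_derivative g' x) (at x)" "derivatives_satisfy Q n g'"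
      using g by auto
    then have "deriv g = g'" by (auto intro: DERIV_imp_deriv)
    with g' show ?thesis by simp
  qed
  have *: "derivatives_satisfy rapidly_decreasing n ((deriv ^^ k) f)" for k n
    by (induction k arbitrary: n) (auto intro: assms deriv simp del: derivatives_satisfy.simps)
  have "(deriv ^^ k) f differentiable (at x)" for k x
    using *[of "Suc 0" k] real_differentiable_def by auto
  moreover have "rapidly_decreasing ((deriv ^^ k) f)" for k
    using *[of 0 k] by simp
  ultimately show ?thesis
    unfolding schwartz_def rapidly_decreasing_def by auto
qed

section \<open>Limits, integrability and the fundamental theorem on unbounded intervals\<close>

lemma rapidly_decreasing_tendsto_0:
  assumes "rapidly_decreasing f"
  shows "(f \<longlongrightarrow> 0) at_infinity"
proof -
  obtain C where C: "\<And>x. \<bar>x\<bar> ^ 1 * \<bar>f x\<bar> \<le> C"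
    using assms unfolding rapidly_decreasing_def by metis
  show ?thesis
  proof (rule Lim_null_comparison)
    show "\<forall>\<^sub>F x in at_infinity. norm (f x) \<le> C * norm (inverse x)"
      using eventually_not_equal_at_infinity[of 0]
      by eventually_elim (use C in \<open>auto simp: field_simps\<close>)
    show "((\<lambda>x::real. C * norm (inverse x)) \<longlongrightarrow> 0) at_infinity"
      by (intro tendsto_mult_right_zero tendsto_norm_zero tendsto_inverse_0)
  qed
qed

text \<open>Adding the decay bounds of orders 0 and 2 dominates |f| by a multiple of 1/(1 +
  x^2).\<close>

lemma rapidly_decreasing_integrable:
  assumes "rapidly_decreasing f" "continuous_on UNIV f"
  shows "integrable lborel f"
proof -
  obtain C where C: "\<And>x. \<bar>x\<bar> ^ 0 * \<bar>f x\<bar> \<le> C"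
    using assms(1) unfolding rapidly_decreasing_def by metis
  obtain D where D: "\<And>x. \<bar>x\<bar> ^ 2 * \<bar>f x\<bar> \<le> D"
    using assms(1) unfolding rapidly_decreasing_def by metis
  have bound: "\<bar>f x\<bar> \<le> \<bar>(C + D) * inverse (1 + x\<^sup>2)\<bar>" for x
  proof -
    have "(1 + x\<^sup>2) * \<bar>f x\<bar> \<le> C + D"
      using C[of x] D[of x] by (simp add: distrib_right)
    moreover have "0 < 1 + x\<^sup>2" by (simp add: add_pos_nonneg)
    ultimately have "\<bar>f x\<bar> \<le> (C + D) * inverse (1 + x\<^sup>2)"
      by (simp add: field_simps)
    then show ?thesis by linarith
  qed
  have "integrable lborel (\<lambda>x::real. inverse (1 + x\<^sup>2))"
    using integrable_inverse_1_plus_square by (simp add: set_integrable_def)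
  then have "integrable lborel (\<lambda>x. (C + D) * inverse (1 + x\<^sup>2))" by simp
  then show ?thesis
    by (rule Bochner_Integration.integrable_bound)
       (use bound assms(2) in \<open>auto intro!: borel_measurable_continuous_onI\<close>)
qed

text \<open>\<open>Kfun\<close> is a gauge integral over a half-line. Absolute integrability
  identifies it with the Lebesgue integral, which is the limit of the integrals over [y, x] as y
  tends to -\<infinity>.\<close>

lemma integral_atMost_FTC:
  fixes F f :: "real \<Rightarrow> real"
  assumes F: "\<And>x. (F has_real_derivative f x) (at x)"
    and f: "integrable lborel f" and A: "(F \<longlongrightarrow> A) at_bot"
  shows "integral {..x} f = F x - A"
proof -
  have set: "set_integrable lborel S f" if "S \<in> sets borel" for S
    unfolding set_integrable_def using f that by (intro integrable_mult_indicator) auto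
  have "((\<lambda>y. LINT u:{y..x}|lborel. f u) \<longlongrightarrow> (LINT u:{..x}|lborel. f u)) at_bot"
    by (intro tendsto_set_lebesgue_integral_at_bot set) auto
  moreover have "\<forall>\<^sub>F y in at_bot. (LINT u:{y..x}|lborel. f u) = F x - F y"
    using eventually_le_at_bot[of x]
  proof eventually_elim
    case (elim y)
    have "(LINT u:{y..x}|lborel. f u) = integral {y..x} f"
      by (intro set_borel_integral_eq_integral set) auto
    also have "\<dots> = F x - F y"
      by (intro integral_unique fundamental_theorem_of_calculus elim)
        (auto simp: has_real_derivative_iff_has_vector_derivative[symmetric]
          intro: has_field_derivative_at_within F)
    finally show ?case .
  qed
  ultimately have "((\<lambda>y. F x - F y) \<longlongrightarrow> (LINT u:{..x}|lborel. f u)) at_bot"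
    by (rule Lim_transform_eventually)
  moreover have "((\<lambda>y. F x - F y) \<longlongrightarrow> F x - A) at_bot"
    by (intro tendsto_intros A)
  ultimately have "(LINT u:{..x}|lborel. f u) = F x - A"
    by (intro tendsto_unique[OF trivial_limit_at_bot_linorder])
  then show ?thesis
    using set_borel_integral_eq_integral(2)[OF set[of "{..x}"]] by simp
qed

lemma integral_UNIV_FTC:
  fixes F f :: "real \<Rightarrow> real"
  assumes F: "\<And>x. (F has_real_derivative f x) (at x)"
    and f: "integrable lborel f"
    and A: "(F \<longlongrightarrow> A) at_bot" and B: "(F \<longlongrightarrow> B) at_top"
  shows "integral\<^sup>L lborel f = B - A"
proof -
  have "(\<integral>u. indicator {..x} u *\<^sub>R f u \<partial>lborel) = F x - A" for x
  proof -
    have "set_integrable lborel {..x} f"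
      unfolding set_integrable_def using f by (intro integrable_mult_indicator) auto
    from set_borel_integral_eq_integral(2)[OF this] integral_atMost_FTC[OF F f A]
    show ?thesis by (simp add: set_lebesgue_integral_def)
  qed
  then have "((\<lambda>x. F x - A) \<longlongrightarrow> integral\<^sup>L lborel f) at_top"
    using tendsto_integral_at_top[OF _ f] by simp
  moreover have "((\<lambda>x. F x - A) \<longlongrightarrow> B - A) at_top"
    by (intro tendsto_intros B)
  ultimately show ?thesis
    by (intro tendsto_unique[OF trivial_limit_at_top_linorder])
qed

section \<open>Hermite functions\<close>

definition gauss :: "real \<Rightarrow> real" where
  "gauss x = exp (- (x\<^sup>2 / 2))"

lemma gauss_pos: "0 < gauss x"
  by (simp add: gauss_def)

lemma has_derivative_gauss: "(gauss has_real_derivative - x * gauss x) (at x)"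
  unfolding gauss_def by (auto intro!: derivative_eq_intros)

lemma has_derivative_poly_gauss:
  "((\<lambda>x. poly q x * gauss x) has_real_derivative poly (pderiv q - pCons 0 q) x * gauss x) (at x)"
  by (auto intro!: derivative_eq_intros has_derivative_gauss poly_DERIV simp: algebra_simps)

lemma continuous_poly_gauss: "continuous_on UNIV (\<lambda>x. poly q x * gauss x)"
  using has_derivative_poly_gauss DERIV_isCont continuous_at_imp_continuous_on by blast

text \<open>A single term of the exponential series gives |x|^(2m) \<le> 2^m m! exp(x^2/2), and
  |x|^m \<le> 1 + |x|^(2m) covers all exponents.\<close>

lemma rapidly_decreasing_gauss: "rapidly_decreasing gauss"
  unfolding rapidly_decreasing_def
proof
  fix m
  have "\<bar>x\<bar> ^ m * \<bar>gauss x\<bar> \<le> 1 + 2 ^ m * fact m" for x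
  proof -
    have "(x\<^sup>2 / 2) ^ m / fact m \<le> exp (x\<^sup>2 / 2)"
    proof -
      \<comment> \<open>The Taylor point x^2/2 is nonnegative, hence so is the remainder, and the
        partial sum up to the term of degree m is a lower bound.\<close>
      obtain t where "exp (x\<^sup>2 / 2) =
          (\<Sum>k<Suc m. (x\<^sup>2 / 2) ^ k / fact k) + exp t / fact (Suc m) * (x\<^sup>2 / 2) ^ Suc m"
        using Maclaurin_exp_le by blast
      then have "exp (x\<^sup>2 / 2) \<ge> (\<Sum>k<Suc m. (x\<^sup>2 / 2) ^ k / fact k)"
        by simp
      moreover have "(\<Sum>k<m. (x\<^sup>2 / 2) ^ k / fact k) \<ge> 0"
        by (intro sum_nonneg) simp
      ultimately show ?thesis by simp
    qed
    then have "\<bar>x\<bar> ^ (2 * m) \<le> 2 ^ m * fact m * exp (x\<^sup>2 / 2)"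
      unfolding power_mult power2_abs by (simp add: power_divide field_simps)
    moreover have "\<bar>x\<bar> ^ m \<le> 1 + \<bar>x\<bar> ^ (2 * m)"
    proof (cases "\<bar>x\<bar> \<le> 1")
      case True
      then show ?thesis by (simp add: power_le_one add_increasing2)
    next
      case False
      then have "\<bar>x\<bar> ^ m \<le> \<bar>x\<bar> ^ (2 * m)" by (intro power_increasing) auto
      then show ?thesis by simp
    qed
    moreover have "1 \<le> exp (x\<^sup>2 / 2)" by simp
    ultimately have "\<bar>x\<bar> ^ m \<le> (1 + 2 ^ m * fact m) * exp (x\<^sup>2 / 2)"
      unfolding distrib_right by linarith
    then show ?thesis by (simp add: gauss_def exp_minus field_simps)
  qed
  then show "\<exists>C. \<forall>x. \<bar>x\<bar> ^ m * \<bar>gauss x\<bar> \<le> C" by blast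
qed

section \<open>Products of a polynomial and the Gaussian\<close>

lemma polynomially_bounded_poly: "polynomially_bounded (poly q)"
proof (induction q)
  case 0
  then show ?case by (intro polynomially_boundedI[of _ 0 0]) simp
next
  case (pCons a q)
  have "polynomially_bounded (\<lambda>x. a)"
    by (rule polynomially_boundedI[of _ "\<bar>a\<bar>" 0]) simp
  moreover have "polynomially_bounded (\<lambda>x. x)"
    by (rule polynomially_boundedI[of _ 1 1]) simp
  ultimately show ?case
    using pCons polynomially_bounded_add polynomially_bounded_mult by (simp add: poly_pCons fun_eq_iff)
qed

lemma rapidly_decreasing_poly_gauss: "rapidly_decreasing (\<lambda>x. poly q x * gauss x)"
  by (intro rapidly_decreasing_mult polynomially_bounded_poly rapidly_decreasing_gauss)

lemma derivatives_rapidly_decreasing_poly_gauss: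
  "derivatives_satisfy rapidly_decreasing n (\<lambda>x. poly q x * gauss x)"
proof (induction n arbitrary: q)
  case (Suc n)
  then show ?case
    unfolding derivatives_satisfy.simps
    by (intro conjI exI[of _ "\<lambda>x. poly (pderiv q - pCons 0 q) x * gauss x"] allI
        has_derivative_poly_gauss rapidly_decreasing_poly_gauss)
qed (simp add: rapidly_decreasing_poly_gauss)

lemma integrable_poly_gauss: "integrable lborel (\<lambda>x. poly q x * gauss x)"
  by (intro rapidly_decreasing_integrable rapidly_decreasing_poly_gauss continuous_poly_gauss)

text \<open>The integrand is the derivative of \<open>poly q x * gauss x\<close>, which vanishes at
  both ends. This is integration by parts against the Gaussian weight.\<close>

lemma integral_deriv_poly_gauss:
  "(\<integral>x. poly (pderiv q - pCons 0 q) x * gauss x \<partial>lborel) = 0"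
proof -
  have "((\<lambda>x. poly q x * gauss x) \<longlongrightarrow> 0) at_infinity"
    by (intro rapidly_decreasing_tendsto_0 rapidly_decreasing_poly_gauss)
  then have "((\<lambda>x. poly q x * gauss x) \<longlongrightarrow> 0) at_bot" "((\<lambda>x. poly q x * gauss x) \<longlongrightarrow> 0) at_top"
    using at_bot_le_at_infinity at_top_le_at_infinity tendsto_mono by blast+
  from integral_UNIV_FTC[OF has_derivative_poly_gauss integrable_poly_gauss this]
  show ?thesis by simp
qed

text \<open>These are the probabilists' Hermite polynomials: the n-th derivative of
  \<open>gauss\<close> is (-1)^n \<open>hermite n\<close> times \<open>gauss\<close>.\<close>

primrec hermite :: "nat \<Rightarrow> real poly" where
  "hermite 0 = 1"
| "hermite (Suc n) = pCons 0 (hermite n) - pderiv (hermite n)"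

text \<open>Differentiating the recursion for H_(n+2) gives H_(n+1) + x H_(n+1)' - H_(n+1)''. By
  induction the last two terms are (n+1)(x H_n - H_n') = (n+1) H_(n+1).\<close>

lemma pderiv_hermite: "pderiv (hermite (Suc n)) = smult (real (Suc n)) (hermite n)"
proof (induction n)
  case (Suc n)
  have "pderiv (hermite (Suc (Suc n))) =
      hermite (Suc n) + pCons 0 (pderiv (hermite (Suc n))) - pderiv (pderiv (hermite (Suc n)))"
    by (subst hermite.simps(2)) (simp only: pderiv_diff pderiv_pCons)
  also have "\<dots> = hermite (Suc n) + smult (real (Suc n)) (hermite (Suc n))"
    unfolding Suc.IH pderiv_smult by (simp add: smult_diff_right)
  also have "\<dots> = smult (1 + real (Suc n)) (hermite (Suc n))"
    by (simp only: smult_add_left smult_1_left)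
  finally show ?case by (simp only: of_nat_Suc)
qed (simp add: pderiv_pCons)

text \<open>This three-term recurrence yields both the values at 0 and the second-order differential
  equation behind the energy estimate.\<close>

lemma hermite_Suc_Suc:
  "hermite (Suc (Suc n)) = pCons 0 (hermite (Suc n)) - smult (real (Suc n)) (hermite n)"
  by (subst hermite.simps(2)) (simp only: pderiv_hermite)

lemma has_derivative_hermite_gauss:
  "((\<lambda>x. poly (hermite n) x * gauss x) has_real_derivative
     - (poly (hermite (Suc n)) x * gauss x)) (at x)"
  using has_derivative_poly_gauss[of "hermite n" x] by (simp add: algebra_simps)

text \<open>At 0 the recurrence reads H_(n+2)(0) = -(n+1) H_n(0), so values two indices apart
  determine each other: the odd ones start from 0, the even ones from 1.\<close>

lemma poly_hermite_odd_0: "poly (hermite (Suc (2 * n))) 0 = 0"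
proof (induction n)
  case (Suc n)
  then show ?case by (simp add: hermite_Suc_Suc del: hermite.simps)
qed simp

lemma poly_hermite_even_0: "poly (hermite (2 * n)) 0 \<noteq> 0"
proof (induction n)
  case (Suc n)
  then show ?case by (simp add: hermite_Suc_Suc del: hermite.simps)
qed simp

lemma hermite_moment_0:
  "k < n \<Longrightarrow> (\<integral>x. x ^ k * (poly (hermite n) x * gauss x) \<partial>lborel) = 0"
proof (induction n arbitrary: k)
  case (Suc n)
  \<comment> \<open>With q = x^k H_n one has x^k H_(n+1) = k x^(k-1) H_n - (q' - x q), and the
    bracket integrates to 0 against the Gaussian. Thus k and n drop together.\<close>
  define q where "q = monom 1 k * hermite n"
  have *: "x ^ k * (poly (hermite (Suc n)) x * gauss x) =
      real k * (x ^ (k - 1) * (poly (hermite n) x * gauss x))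
      - poly (pderiv q - pCons 0 q) x * gauss x" for x
    by (simp add: q_def pderiv_mult pderiv_monom poly_monom algebra_simps)
  have "integrable lborel (\<lambda>x. poly (monom 1 (k - 1) * hermite n) x * gauss x)"
    by (rule integrable_poly_gauss)
  then have "integrable lborel (\<lambda>x. x ^ (k - 1) * (poly (hermite n) x * gauss x))"
    by (simp add: poly_monom mult_ac)
  then have "(\<integral>x. x ^ k * (poly (hermite (Suc n)) x * gauss x) \<partial>lborel) =
      real k * (\<integral>x. x ^ (k - 1) * (poly (hermite n) x * gauss x) \<partial>lborel)
      - (\<integral>x. poly (pderiv q - pCons 0 q) x * gauss x \<partial>lborel)"
    unfolding * by (subst Bochner_Integration.integral_diff) (auto intro: integrable_poly_gauss simp del: poly_diff)
  also have "\<dots> = 0"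
    \<comment> \<open>For k = 0 the truncated exponent k - 1 is harmless, because the factor
      \<open>real k\<close> is 0.\<close>
    unfolding integral_deriv_poly_gauss using Suc.IH[of "k - 1"] Suc.prems by (cases k) auto
  finally show ?case .
qed simp

text \<open>For u'' + y u' + c u = 0 the energy E = v^2 + c u^2 has derivative -2 y v^2. If u(x)^2
  were at least u(0)^2, then E would be constant on [0, x], which forces v = 0 inside, then u(x/2) =
  0 by the equation, and so E(x/2) = 0 < E(0).\<close>

lemma damped_oscillator_less_initial:
  fixes u v :: "real \<Rightarrow> real"
  assumes u: "\<And>y. (u has_real_derivative v y) (at y)"
    and v: "\<And>y. (v has_real_derivative - y * v y - c * u y) (at y)"
    and "0 < c" "v 0 = 0" "u 0 \<noteq> 0" "0 < x"
  shows "(u x)\<^sup>2 < (u 0)\<^sup>2"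
proof (rule ccontr)
  assume "\<not> (u x)\<^sup>2 < (u 0)\<^sup>2"
  define E where "E y = (v y)\<^sup>2 + c * (u y)\<^sup>2" for y
  have E: "(E has_real_derivative - 2 * y * (v y)\<^sup>2) (at y)" for y
    unfolding E_def
    by (auto intro!: derivative_eq_intros u v simp: algebra_simps power2_eq_square)
  have mono: "E b \<le> E a" if "0 \<le> a" "a \<le> b" for a b
  proof (rule DERIV_nonpos_imp_nonincreasing[OF \<open>a \<le> b\<close>])
    fix y assume "a \<le> y" "y \<le> b"
    then show "\<exists>z. (E has_real_derivative z) (at y) \<and> z \<le> 0"
      using E[of y] \<open>0 \<le> a\<close> by (intro exI[of _ "- 2 * y * (v y)\<^sup>2"]) auto
  qed
  have "E 0 \<le> E x"
    using \<open>\<not> (u x)\<^sup>2 < (u 0)\<^sup>2\<close> \<open>0 < c\<close> \<open>v 0 = 0\<close> unfolding E_def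
    by (simp add: add_increasing)
  then have const: "E y = E 0" if "0 \<le> y" "y \<le> x" for y
    using mono[of 0 y] mono[of y x] that by simp
  have v0: "v y = 0" if "0 < y" "y < x" for y
  proof -
    \<comment> \<open>Within this distance of y the point z stays in [0, x], so E is locally
      constant at y and its derivative there vanishes.\<close>
    have "E y = E z" if "\<bar>y - z\<bar> < min y (x - y)" for z
    proof -
      have "0 \<le> z" "z \<le> x" using that \<open>0 < y\<close> \<open>y < x\<close> by linarith+
      then show ?thesis using const[of y] const[of z] \<open>0 < y\<close> \<open>y < x\<close> by simp
    qed
    then have "- 2 * y * (v y)\<^sup>2 = 0"
      using that by (intro DERIV_local_const[OF E, of "min y (x - y)"]) auto
    then show ?thesis using that by simp
  qed
  \<comment> \<open>v vanishes around the midpoint, so its derivative vanishes there too; the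
    differential equation then turns this into c u(x/2) = 0.\<close>
  have "v (x / 2) = v z" if "\<bar>x / 2 - z\<bar> < x / 2" for z
  proof -
    have "0 < z" "z < x" using that by linarith+
    then show ?thesis using v0[of z] v0[of "x / 2"] by simp
  qed
  then have "- (x / 2) * v (x / 2) - c * u (x / 2) = 0"
    using \<open>0 < x\<close> by (intro DERIV_local_const[OF v, of "x / 2"]) auto
  moreover have "v (x / 2) = 0" "E (x / 2) = E 0"
    using v0[of "x / 2"] const[of "x / 2"] \<open>0 < x\<close> by auto
  ultimately show False
    using assms(3-5) by (simp add: E_def)
qed

text \<open>\<open>damped_oscillator_less_initial\<close> applies with c = 2m + 1. Squares are
  compared because the sign of H_(2m)(0) alternates with m.\<close>

lemma hermite_gauss_less_initial:
  assumes "x \<noteq> 0"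
  shows "(poly (hermite (2 * m)) x * gauss x)\<^sup>2 < (poly (hermite (2 * m)) 0)\<^sup>2"
proof -
  define u where "u y = poly (hermite (2 * m)) y * gauss y" for y
  define v where "v y = - (poly (hermite (Suc (2 * m))) y * gauss y)" for y
  define c where "c = real (Suc (2 * m))"
  have u: "(u has_real_derivative v y) (at y)" for y
    unfolding u_def v_def by (rule has_derivative_hermite_gauss)
  have v: "(v has_real_derivative - y * v y - c * u y) (at y)" for y
    \<comment> \<open>The derivative of v is H_(2m+2) \<open>gauss\<close>, which the three-term
      recurrence rewrites as -y v - c u.\<close>
    using DERIV_minus[OF has_derivative_hermite_gauss[of "Suc (2 * m)" y]]
    unfolding v_def u_def c_def hermite_Suc_Suc
    by (simp add: algebra_simps del: hermite.simps)
  have 0: "u 0 = poly (hermite (2 * m)) 0" "v 0 = 0" "u 0 \<noteq> 0" "0 < c"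
    using poly_hermite_odd_0[of m] poly_hermite_even_0[of m]
    by (simp_all add: u_def v_def c_def gauss_def del: hermite.simps)
  have "(u x)\<^sup>2 < (u 0)\<^sup>2"
  proof (cases "0 < x")
    case True
    then show ?thesis
      using damped_oscillator_less_initial[OF u v] 0 by blast
  next
    case False
    \<comment> \<open>The equation is invariant under the reflection y to -y, so negative x reduces
      to positive x.\<close>
    have u': "((\<lambda>y. u (- y)) has_real_derivative - v (- y)) (at y)" for y
      using DERIV_chain2[OF u DERIV_minus[OF DERIV_ident], of y] by simp
    have v': "((\<lambda>y. - v (- y)) has_real_derivative - y * - v (- y) - c * u (- y)) (at y)" for y
      using DERIV_minus[OF DERIV_chain2[OF v DERIV_minus[OF DERIV_ident], of y]] by (simp add: algebra_simps)
    show ?thesis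
      using damped_oscillator_less_initial[OF u' v', of "- x"] 0 False assms by auto
  qed
  then show ?thesis using 0 by (simp add: u_def)
qed

section \<open>The square root of a function with a double zero\<close>

text \<open>If \<open>\<phi>(0) = 0\<close> and \<open>\<phi>' = x \<cdot> q \<cdot> gauss\<close>, then \<open>\<phi>(x) / x\<^sup>2\<close> is \<open>dilation_mean 1 q x\<close>, which has no
  singularity at \<open>0\<close>.\<close>
definition dilation_mean :: "nat \<Rightarrow> real poly \<Rightarrow> real \<Rightarrow> real" where
  "dilation_mean j q x = integral {0..1} (\<lambda>s. s ^ j * (poly q (s * x) * gauss (s * x)))"

lemma continuous_on_gauss [continuous_intros]:
  "continuous_on S f \<Longrightarrow> continuous_on S (\<lambda>x. gauss (f x))"
  unfolding gauss_def by (intro continuous_intros) auto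

text \<open>Differentiating under the integral brings out one factor s, which raises
  \<open>j\<close>, and acts on the polynomial as q to q' - x q. The family is therefore closed
  under differentiation.\<close>

lemma has_derivative_dilation_mean:
  "(dilation_mean j q has_real_derivative dilation_mean (Suc j) (pderiv q - pCons 0 q) x) (at x)"
proof -
  have "((\<lambda>x. integral (cbox 0 1) (\<lambda>s. s ^ j * (poly q (s * x) * gauss (s * x)))) has_real_derivative
      integral (cbox 0 1) (\<lambda>s. s ^ Suc j * (poly (pderiv q - pCons 0 q) (s * x) * gauss (s * x))))
    (at x within UNIV)"
  proof (rule leibniz_rule_field_derivative)
    fix x s :: real
    show "((\<lambda>x. s ^ j * (poly q (s * x) * gauss (s * x))) has_real_derivative
        s ^ Suc j * (poly (pderiv q - pCons 0 q) (s * x) * gauss (s * x))) (at x within UNIV)"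
      using DERIV_cmult[OF DERIV_chain2[OF has_derivative_poly_gauss DERIV_cmult[OF DERIV_ident]],
          of "s ^ j" q s x]
      by (simp add: algebra_simps)
    show "(\<lambda>s. s ^ j * (poly q (s * x) * gauss (s * x))) integrable_on cbox 0 1"
      by (intro integrable_continuous continuous_intros)
    show "continuous_on (UNIV \<times> cbox 0 1)
        (\<lambda>(x, s). s ^ Suc j * (poly (pderiv q - pCons 0 q) (s * x) * gauss (s * x)))"
      unfolding split_beta by (intro continuous_intros)
  qed auto
  then show ?thesis by (simp add: dilation_mean_def[abs_def])
qed

text \<open>Even a constant bound holds: s^j is at most 1 on [0, 1] and
  \<open>poly q x * gauss x\<close> is bounded.\<close>

lemma polynomially_bounded_dilation_mean: "polynomially_bounded (dilation_mean j q)"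
proof -
  obtain C where C: "\<And>x. \<bar>x\<bar> ^ 0 * \<bar>poly q x * gauss x\<bar> \<le> C"
    using rapidly_decreasing_poly_gauss[of q] unfolding rapidly_decreasing_def by metis
  have "\<bar>dilation_mean j q x\<bar> \<le> C" for x
  proof -
    have "norm (integral (cbox 0 1) (\<lambda>s. s ^ j * (poly q (s * x) * gauss (s * x))))
        \<le> C * measure lborel (cbox 0 (1::real))"
    proof (rule integrable_bound)
      show "0 \<le> C" using order_trans[OF abs_ge_zero C[of 0, simplified]] .
      show "(\<lambda>s. s ^ j * (poly q (s * x) * gauss (s * x))) integrable_on cbox 0 1"
        by (intro integrable_continuous continuous_intros)
      fix s :: real assume "s \<in> cbox 0 1"
      then have "\<bar>s ^ j\<bar> \<le> 1" by (simp add: power_le_one)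
      then show "norm (s ^ j * (poly q (s * x) * gauss (s * x))) \<le> C"
        using mult_mono[of "\<bar>s ^ j\<bar>" 1 "\<bar>poly q (s * x) * gauss (s * x)\<bar>" C] C[of "s * x"]
        by (simp add: abs_mult)
    qed
    then show ?thesis by (simp add: dilation_mean_def)
  qed
  then show ?thesis by (intro polynomially_boundedI[of _ C 0]) simp
qed

lemma derivatives_polynomially_bounded_dilation_mean:
  "derivatives_satisfy polynomially_bounded n (dilation_mean j q)"
proof (induction n arbitrary: j q)
  case (Suc n)
  then show ?case
    unfolding derivatives_satisfy.simps
    by (intro conjI exI[of _ "dilation_mean (Suc j) (pderiv q - pCons 0 q)"] allI
        has_derivative_dilation_mean polynomially_bounded_dilation_mean)
qed (simp add: polynomially_bounded_dilation_mean)

text \<open>The fundamental theorem in s, applied on [0, 1] to s^2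
  \<open>poly q (s * x) * gauss (s * x)\<close>. With R = \<open>dilation_mean 1 q\<close> it is the
  identity (x^2 R)' = x q \<open>gauss\<close> divided by x, valid at x = 0 as well.\<close>

lemma dilation_mean_euler:
  "2 * dilation_mean 1 q x + x * dilation_mean 2 (pderiv q - pCons 0 q) x = poly q x * gauss x"
proof -
  define f where "f s = s\<^sup>2 * (poly q (s * x) * gauss (s * x))" for s
  let ?a = "\<lambda>s. s ^ 1 * (poly q (s * x) * gauss (s * x))"
  let ?b = "\<lambda>s. s\<^sup>2 * (poly (pderiv q - pCons 0 q) (s * x) * gauss (s * x))"
  have "(f has_real_derivative 2 * ?a s + x * ?b s) (at s)" for s
  proof -
    have "((\<lambda>s. poly q (s * x) * gauss (s * x)) has_real_derivative
        poly (pderiv q - pCons 0 q) (s * x) * gauss (s * x) * x) (at s)"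
      using DERIV_chain2[OF has_derivative_poly_gauss DERIV_cmult_right[OF DERIV_ident]] by simp
    from DERIV_mult[OF DERIV_power[OF DERIV_ident, of 2] this] show ?thesis
      unfolding f_def by (simp add: algebra_simps)
  qed
  then have "((\<lambda>s. 2 * ?a s + x * ?b s) has_integral f 1 - f 0) {0..1}"
    by (intro fundamental_theorem_of_calculus)
      (auto simp: has_real_derivative_iff_has_vector_derivative[symmetric]
        intro: has_field_derivative_at_within)
  moreover have "((\<lambda>s. 2 * ?a s + x * ?b s) has_integral
      2 * dilation_mean 1 q x + x * dilation_mean 2 (pderiv q - pCons 0 q) x) {0..1}"
    unfolding dilation_mean_def
    by (intro has_integral_add has_integral_mult_right integrable_integral
        integrable_continuous_real continuous_intros)
  ultimately have "f 1 - f 0 = 2 * dilation_mean 1 q x + x * dilation_mean 2 (pderiv q - pCons 0 q) x"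
    by (rule has_integral_unique)
  then show ?thesis by (simp add: f_def)
qed

lemma derivatives_polynomially_bounded_const:
  "derivatives_satisfy polynomially_bounded n (\<lambda>x. c)"
proof (induction n arbitrary: c)
  case 0
  show ?case by (auto intro: polynomially_boundedI[of _ "\<bar>c\<bar>" 0])
next
  case (Suc n)
  have "polynomially_bounded (\<lambda>x. c)" by (auto intro: polynomially_boundedI[of _ "\<bar>c\<bar>" 0])
  with Suc show ?case by (auto intro!: exI[of _ "\<lambda>x. 0"])
qed

text \<open>With \<phi> = x^2 R and J = 1/sqrt R, the derivative \<phi>'/(2F) of F = x sqrt R
  becomes J q \<open>gauss\<close>/2, since the factor x cancels. Rapid decrease of \<open>f\<close>
  thus reduces to polynomial growth of J and its derivatives.\<close>

lemma smooth_square_root_at_double_zero: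
  fixes \<phi> :: "real \<Rightarrow> real"
  assumes \<phi>': "\<And>x. (\<phi> has_real_derivative x * (poly q x * gauss x)) (at x)"
    and "\<phi> 0 = 0" and pos: "\<And>x. x \<noteq> 0 \<Longrightarrow> 0 < \<phi> x" and "0 < poly q 0"
    and lim: "(\<phi> \<longlongrightarrow> 1) at_infinity"
  obtains F f where
    "\<And>x. (F has_real_derivative f x) (at x)"
    "\<And>n. derivatives_satisfy rapidly_decreasing n f"
    "\<And>x. (F x)\<^sup>2 = \<phi> x" "\<And>x. 0 < x \<Longrightarrow> 0 < F x" "\<And>x. x < 0 \<Longrightarrow> F x < 0"
    "\<And>x. F x * f x = x * (poly q x * gauss x) / 2"
proof -
  define R where "R = dilation_mean 1 q"
  define R' where "R' = dilation_mean 2 (pderiv q - pCons 0 q)"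
  define J where "J x = 1 / sqrt (R x)" for x
  have R: "(R has_real_derivative R' x) (at x)" for x
    unfolding R_def R'_def using has_derivative_dilation_mean[of 1 q x] by (simp add: numeral_2_eq_2)
  have euler: "2 * R x + x * R' x = poly q x * gauss x" for x
    unfolding R_def R'_def by (rule dilation_mean_euler)
  have \<phi>: "\<phi> x = x\<^sup>2 * R x" for x
  proof -
    have "((\<lambda>x. \<phi> x - x\<^sup>2 * R x) has_real_derivative 0) (at y)" for y
    proof -
      have "((\<lambda>x. \<phi> x - x\<^sup>2 * R x) has_real_derivative
          y * (poly q y * gauss y) - (2 * y * R y + y\<^sup>2 * R' y)) (at y)"
        by (auto intro!: derivative_eq_intros \<phi>' R)
      also have "y * (poly q y * gauss y) - (2 * y * R y + y\<^sup>2 * R' y) = 0"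
        unfolding euler[symmetric] by (simp add: algebra_simps power2_eq_square)
      finally show ?thesis .
    qed
    then have "\<phi> x - x\<^sup>2 * R x = \<phi> 0 - 0\<^sup>2 * R 0"
      by (intro DERIV_isconst_all) auto
    then show ?thesis using \<open>\<phi> 0 = 0\<close> by simp
  qed
  \<comment> \<open>Off 0 this is positivity of \<phi>; at 0 the Euler identity gives 2 R(0) = q(0)
    \<open>gauss 0\<close>.\<close>
  have R_pos: "0 < R x" for x
  proof (cases "x = 0")
    case True
    then show ?thesis
      using euler[of 0] mult_pos_pos[OF \<open>0 < poly q 0\<close> gauss_pos[of 0]] by simp
  next
    case False
    then show ?thesis using pos[of x] \<phi>[of x] by (simp add: zero_less_mult_iff)
  qed
  \<comment> \<open>J' is written as a polynomial in R' and J, so that smoothness of J follows by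
    induction on the order.\<close>
  have J: "(J has_real_derivative (- 1 / 2) * R' x * (J x * (J x * J x))) (at x)" for x
    unfolding J_def using R_pos[of x]
    by (auto intro!: derivative_eq_intros R simp: field_simps power2_eq_square)
  have J_pos: "0 < J x" for x
    unfolding J_def using R_pos by simp
  \<comment> \<open>On a compact interval J is bounded by continuity. Beyond it \<phi> > 1/2, so 4
    x^2 R \<ge> 1 and J \<le> 2|x|.\<close>
  have J_bounded: "polynomially_bounded J"
  proof -
    have "\<forall>\<^sub>F x in at_infinity. 1 / 2 < \<phi> x"
      using lim by (rule order_tendstoD) simp
    then obtain B where B: "\<And>x. B \<le> \<bar>x\<bar> \<Longrightarrow> 1 / 2 < \<phi> x"
      by (auto simp: eventually_at_infinity)
    have "compact (J ` {- B..B})"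
      using J by (intro compact_continuous_image compact_Icc continuous_at_imp_continuous_on)
        (auto intro: DERIV_isCont)
    then obtain M where M: "\<And>x. x \<in> {- B..B} \<Longrightarrow> \<bar>J x\<bar> \<le> M"
      using compact_imp_bounded bounded_iff by (metis imageI real_norm_def)
    have "\<bar>J x\<bar> \<le> (\<bar>M\<bar> + 2) * (1 + \<bar>x\<bar>) ^ 1" for x
    proof (cases "\<bar>x\<bar> \<le> B")
      case True
      then have "\<bar>J x\<bar> \<le> \<bar>M\<bar>" using M[of x] by (simp add: abs_le_iff)
      then show ?thesis by (simp add: algebra_simps add_increasing2)
    next
      case False
      then have "1 \<le> (2 * \<bar>x\<bar>)\<^sup>2 * R x"
        using B[of x] \<phi>[of x] by (simp add: power_mult_distrib)
      then have "1 \<le> (2 * \<bar>x\<bar>) * sqrt (R x)"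
        using R_pos[of x] real_sqrt_le_mono by (fastforce simp: real_sqrt_mult)
      then have "\<bar>J x\<bar> \<le> 2 * \<bar>x\<bar>"
        unfolding J_def using R_pos[of x] by (simp add: field_simps)
      also have "\<dots> \<le> (\<bar>M\<bar> + 2) * (1 + \<bar>x\<bar>) ^ 1"
        by (simp add: algebra_simps)
      finally show ?thesis .
    qed
    then show ?thesis by (rule polynomially_boundedI)
  qed
  have J_smooth: "derivatives_satisfy polynomially_bounded n J" for n
  proof (induction n)
    case (Suc n)
    have "derivatives_satisfy polynomially_bounded n (\<lambda>x. (- 1 / 2) * R' x * (J x * (J x * J x)))"
      unfolding R'_def
      by (intro derivatives_polynomially_bounded_mult Suc.IH
          derivatives_polynomially_bounded_const derivatives_polynomially_bounded_dilation_mean)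
    then show ?case
      unfolding derivatives_satisfy.simps
      by (intro conjI exI[of _ "\<lambda>x. (- 1 / 2) * R' x * (J x * (J x * J x))"] allI J J_bounded)
  qed (simp add: J_bounded)
  have JR: "J x * J x * R x = 1" for x
    unfolding J_def using R_pos[of x] by (simp add: field_simps)
  \<comment> \<open>This is x sqrt R, expressed through J so that J^2 R = 1 simplifies every later
    computation.\<close>
  define F where "F x = x * R x * J x" for x
  define f where "f x = (1 / 2 * J x) * (poly q x * gauss x)" for x
  show ?thesis
  proof (rule that[of F f])
    show "(F has_real_derivative f x) (at x)" for x
    proof -
      have "(F has_real_derivative (R x + x * R' x) * J x
          + x * R x * ((- 1 / 2) * R' x * (J x * (J x * J x)))) (at x)"
        unfolding F_def by (auto intro!: derivative_eq_intros J R simp: algebra_simps)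
      also have "(R x + x * R' x) * J x + x * R x * ((- 1 / 2) * R' x * (J x * (J x * J x))) =
          (R x + x * R' x) * J x - 1 / 2 * x * R' x * J x * (J x * J x * R x)"
        by (simp add: algebra_simps)
      also have "\<dots> = f x"
        unfolding JR f_def euler[symmetric] by (simp add: algebra_simps)
      finally show ?thesis .
    qed
    show "derivatives_satisfy rapidly_decreasing n f" for n
      unfolding f_def
      by (intro derivatives_rapidly_decreasing_mult derivatives_polynomially_bounded_mult J_smooth
          derivatives_polynomially_bounded_const derivatives_rapidly_decreasing_poly_gauss)
    show "(F x)\<^sup>2 = \<phi> x" for x
    proof -
      have "(F x)\<^sup>2 = x\<^sup>2 * R x * (J x * J x * R x)"
        by (simp add: F_def power2_eq_square)
      then show ?thesis by (simp add: JR \<phi>)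
    qed
    show "0 < x \<Longrightarrow> 0 < F x" "x < 0 \<Longrightarrow> F x < 0" for x
      using R_pos[of x] J_pos[of x] by (auto simp: F_def mult_neg_pos)
    show "F x * f x = x * (poly q x * gauss x) / 2" for x
    proof -
      have "F x * f x = x * (poly q x * gauss x) / 2 * (J x * J x * R x)"
        by (simp add: F_def f_def)
      then show ?thesis by (simp add: JR)
    qed
  qed
qed

section \<open>Expansions in powers of \<open>\<epsilon>\<close>\<close>

lemma eps_expansion_from_cong:
  assumes "\<And>\<epsilon>. 0 < \<epsilon> \<Longrightarrow> f \<epsilon> = g \<epsilon>" "eps_expansion_from g p"
  shows "eps_expansion_from f p"
proof -
  have "(\<lambda>\<epsilon>. f \<epsilon> - h \<epsilon>) \<in> O[at_right 0](k) \<longleftrightarrow> (\<lambda>\<epsilon>. g \<epsilon> - h \<epsilon>) \<in> O[at_right 0](k)"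
    for h k :: "real \<Rightarrow> real"
  proof (rule landau_o.big.in_cong)
    show "\<forall>\<^sub>F \<epsilon> in at_right 0. f \<epsilon> - h \<epsilon> = g \<epsilon> - h \<epsilon>"
      using eventually_at_right_less[of "0::real"] by eventually_elim (simp add: assms)
  qed
  then show ?thesis
    using assms(2) unfolding eps_expansion_from_def by simp
qed

section \<open>Taylor expansion of a Schwartz function and moment expansions\<close>

lemma schwartz_has_derivative:
  "schwartz \<psi> \<Longrightarrow> ((deriv ^^ n) \<psi> has_real_derivative (deriv ^^ Suc n) \<psi> x) (at x)"
  unfolding schwartz_def by (simp add: DERIV_deriv_iff_real_differentiable)

lemma schwartz_derivative_bounded:
  assumes "schwartz \<psi>"
  obtains M where "0 \<le> M" "\<And>x. \<bar>(deriv ^^ n) \<psi> x\<bar> \<le> M"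
proof -
  obtain M where M: "\<forall>x. \<bar>x\<bar> ^ 0 * \<bar>(deriv ^^ n) \<psi> x\<bar> \<le> M"
    using assms unfolding schwartz_def by blast
  moreover have "0 \<le> M" using order_trans[OF abs_ge_zero M[rule_format, of 0, simplified]] .
  ultimately show ?thesis by (intro that[of M]) auto
qed

text \<open>The Lagrange remainder is controlled by the global bound of the n-th derivative, so
  \<open>M\<close> is uniform in both the base point and the increment.\<close>

lemma schwartz_Taylor_bound:
  assumes "schwartz \<psi>"
  obtains M where "0 \<le> M"
    "\<And>b h. \<bar>\<psi> (b + h) - (\<Sum>k<n. (deriv ^^ k) \<psi> b / fact k * h ^ k)\<bar> \<le> M * \<bar>h\<bar> ^ n"
proof -
  obtain M where M: "0 \<le> M" "\<And>x. \<bar>(deriv ^^ n) \<psi> x\<bar> \<le> M"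
    using schwartz_derivative_bounded[OF assms] by blast
  have "\<bar>\<psi> (b + h) - (\<Sum>k<n. (deriv ^^ k) \<psi> b / fact k * h ^ k)\<bar> \<le> M * \<bar>h\<bar> ^ n" for b h
  proof -
    have "\<forall>m x. ((\<lambda>x. (deriv ^^ m) \<psi> (b + x)) has_real_derivative (deriv ^^ Suc m) \<psi> (b + x)) (at x)"
      using DERIV_chain2[OF schwartz_has_derivative[OF assms] DERIV_add[OF DERIV_const DERIV_ident]]
      by simp
    from Maclaurin_all_le[where diff = "\<lambda>m x. (deriv ^^ m) \<psi> (b + x)", OF refl this, of h n]
    obtain t where "\<psi> (b + h) - (\<Sum>k<n. (deriv ^^ k) \<psi> b / fact k * h ^ k) =
        (deriv ^^ n) \<psi> (b + t) / fact n * h ^ n"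
      by (auto simp only: funpow_0 add_0_right add_diff_cancel_left')
    moreover have "\<bar>(deriv ^^ n) \<psi> (b + t) / fact n\<bar> \<le> M / 1"
      unfolding abs_divide by (intro frac_le) (use M fact_ge_1 in auto)
    ultimately show ?thesis
      by (simp only: abs_mult power_abs div_by_1) (simp add: mult_right_mono del: times_divide_eq_left)
  qed
  with M(1) show ?thesis by (rule that)
qed

lemma integrable_mult_schwartz:
  assumes "schwartz \<psi>" "integrable lborel f"
  shows "integrable lborel (\<lambda>y. f y * \<psi> (b + \<epsilon> * y))"
proof -
  obtain M where M: "0 \<le> M" "\<And>x. \<bar>\<psi> x\<bar> \<le> M"
    using schwartz_derivative_bounded[OF assms(1), of 0] by auto
  have "continuous_on UNIV \<psi>"
    using schwartz_has_derivative[OF assms(1), of 0] DERIV_isCont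
    by (auto intro!: continuous_at_imp_continuous_on)
  then have [measurable]: "\<psi> \<in> borel_measurable borel"
    by (rule borel_measurable_continuous_onI)
  show ?thesis
  proof (rule Bochner_Integration.integrable_bound)
    show "integrable lborel (\<lambda>y. M * f y)" using assms(2) by simp
    show "(\<lambda>y. f y * \<psi> (b + \<epsilon> * y)) \<in> borel_measurable lborel"
      using assms(2) by measurable
    show "AE y in lborel. norm (f y * \<psi> (b + \<epsilon> * y)) \<le> norm (M * f y)"
      using M by (auto simp: abs_mult mult.commute[of M] intro!: mult_left_mono)
  qed
qed

text \<open>Expanding \<psi>(b + \<epsilon> y) in powers of \<epsilon> y and integrating makes the
  coefficient of \<epsilon>^k a multiple of the k-th moment of \<open>f\<close>. The remainder is at
  most M \<epsilon>^n times the integral of |y^n f|.\<close>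

lemma eps_expansion_of_moments:
  fixes f \<psi> :: "real \<Rightarrow> real"
  assumes \<psi>: "schwartz \<psi>" and int: "\<And>k. integrable lborel (\<lambda>y. y ^ k * f y)"
    and moments: "\<And>k. int k < p \<Longrightarrow> (\<integral>y. y ^ k * f y \<partial>lborel) = 0"
  shows "eps_expansion_from (\<lambda>\<epsilon>. \<integral>y. f y * \<psi> (b + \<epsilon> * y) \<partial>lborel) p"
proof -
  define \<mu> where "\<mu> k = (\<integral>y. y ^ k * f y \<partial>lborel)" for k
  define d where "d k = (deriv ^^ k) \<psi> b / fact k" for k
  define \<eta> where "\<eta> k = (if k < 0 then 0 else d (nat k) * \<mu> (nat k))" for k
  have f_int: "integrable lborel f" using int[of 0] by simp
  show ?thesis
    unfolding eps_expansion_from_def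
  proof (intro exI[of _ \<eta>] allI impI)
    fix N :: int assume "p \<le> N"
    \<comment> \<open>The Taylor terms 0, ..., N number N + 1; for negative N there are none and n =
      0.\<close>
    define n where "n = nat (N + 1)"
    obtain M where M: "0 \<le> M"
      "\<And>h. \<bar>\<psi> (b + h) - (\<Sum>k<n. d k * h ^ k)\<bar> \<le> M * \<bar>h\<bar> ^ n"
      using schwartz_Taylor_bound[OF \<psi>, of n] unfolding d_def by metis
    have sum: "(\<Sum>k\<in>{p..N}. \<eta> k * \<epsilon> powi k) = (\<Sum>k<n. d k * \<mu> k * \<epsilon> ^ k)" for \<epsilon>
    proof -
      \<comment> \<open>The index sets differ by naturals below p, whose moments vanish, and by
        negative integers, where \<eta> is 0.\<close>
      have "(\<Sum>k\<in>{p..N}. \<eta> k * \<epsilon> powi k) = (\<Sum>k\<in>int ` {..<n}. \<eta> k * \<epsilon> powi k)"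
      proof (rule sum.mono_neutral_cong)
        fix k assume "k \<in> int ` {..<n} - {p..N}"
        then obtain m where "k = int m" "int m < p" unfolding n_def by auto
        then show "\<eta> k * \<epsilon> powi k = 0" using moments[of m] by (simp add: \<eta>_def \<mu>_def)
      next
        fix k assume k: "k \<in> {p..N} - int ` {..<n}"
        have "k < 0"
        proof (rule ccontr)
          assume "\<not> k < 0"
          then have "k = int (nat k)" "nat k < n" using k unfolding n_def by auto
          then show False using k by blast
        qed
        then show "\<eta> k * \<epsilon> powi k = 0" by (simp add: \<eta>_def)
      qed auto
      also have "\<dots> = (\<Sum>k<n. d k * \<mu> k * \<epsilon> ^ k)"
        by (subst sum.reindex) (auto simp: \<eta>_def)
      finally show ?thesis .
    qed
    define L where "L = (\<integral>y. \<bar>y ^ n * f y\<bar> \<partial>lborel)"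
    have bound: "\<bar>(\<integral>y. f y * \<psi> (b + \<epsilon> * y) \<partial>lborel) - (\<Sum>k\<in>{p..N}. \<eta> k * \<epsilon> powi k)\<bar> \<le> M * L * \<epsilon> ^ n"
      if "0 < \<epsilon>" for \<epsilon>
    proof -
      have int': "integrable lborel (\<lambda>y. d k * \<epsilon> ^ k * (y ^ k * f y))" for k
        using int[of k] by simp
      have "(\<Sum>k\<in>{p..N}. \<eta> k * \<epsilon> powi k) = (\<Sum>k<n. \<integral>y. d k * \<epsilon> ^ k * (y ^ k * f y) \<partial>lborel)"
        unfolding sum \<mu>_def integral_mult_right_zero by (simp add: mult_ac)
      also have "\<dots> = (\<integral>y. (\<Sum>k<n. d k * \<epsilon> ^ k * (y ^ k * f y)) \<partial>lborel)"
        by (rule Bochner_Integration.integral_sum[symmetric]) (rule int')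
      finally have "(\<integral>y. f y * \<psi> (b + \<epsilon> * y) \<partial>lborel) - (\<Sum>k\<in>{p..N}. \<eta> k * \<epsilon> powi k) =
          (\<integral>y. f y * \<psi> (b + \<epsilon> * y) - (\<Sum>k<n. d k * \<epsilon> ^ k * (y ^ k * f y)) \<partial>lborel)"
        by (simp only: Bochner_Integration.integral_diff[OF integrable_mult_schwartz[OF \<psi> f_int]
              Bochner_Integration.integrable_sum[OF int']])
      also have "\<bar>\<dots>\<bar> \<le> (\<integral>y. M * \<epsilon> ^ n * \<bar>y ^ n * f y\<bar> \<partial>lborel)"
        unfolding real_norm_def[symmetric]
      proof (rule Bochner_Integration.integral_norm_bound_integral)
        show "integrable lborel (\<lambda>y. f y * \<psi> (b + \<epsilon> * y) - (\<Sum>k<n. d k * \<epsilon> ^ k * (y ^ k * f y)))"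
          by (intro Bochner_Integration.integrable_diff integrable_mult_schwartz \<psi> f_int
              Bochner_Integration.integrable_sum int')
        show "integrable lborel (\<lambda>y. M * \<epsilon> ^ n * norm (y ^ n * f y))"
          using int[of n] by simp
        fix y
        have "f y * \<psi> (b + \<epsilon> * y) - (\<Sum>k<n. d k * \<epsilon> ^ k * (y ^ k * f y)) =
            f y * (\<psi> (b + \<epsilon> * y) - (\<Sum>k<n. d k * (\<epsilon> * y) ^ k))"
          by (simp add: right_diff_distrib sum_distrib_left power_mult_distrib mult_ac)
        also have "norm \<dots> \<le> \<bar>f y\<bar> * (M * \<bar>\<epsilon> * y\<bar> ^ n)"
          unfolding real_norm_def abs_mult[of "f y"] by (intro mult_left_mono M) auto
        also have "\<dots> = M * \<epsilon> ^ n * norm (y ^ n * f y)"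
          using that by (simp add: abs_mult power_mult_distrib power_abs)
        finally show "norm (f y * \<psi> (b + \<epsilon> * y) - (\<Sum>k<n. d k * \<epsilon> ^ k * (y ^ k * f y)))
            \<le> M * \<epsilon> ^ n * norm (y ^ n * f y)" .
      qed
      also have "\<dots> = M * L * \<epsilon> ^ n"
        unfolding L_def by simp
      finally show ?thesis .
    qed
    have "\<forall>\<^sub>F \<epsilon> in at_right 0. norm ((\<integral>y. f y * \<psi> (b + \<epsilon> * y) \<partial>lborel)
        - (\<Sum>k\<in>{p..N}. \<eta> k * \<epsilon> powi k)) \<le> (M * L) * norm (\<epsilon> powi (N + 1))"
      using eventually_at_right_real[OF zero_less_one]
    proof eventually_elim
      case (elim \<epsilon>)
      \<comment> \<open>The exponent n exceeds N + 1 when N + 1 is negative; \<epsilon> < 1 makes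
        the comparison go the right way.\<close>
      have "\<epsilon> ^ n = \<epsilon> powi int n" by simp
      also have "\<dots> \<le> \<epsilon> powi (N + 1)"
        using elim unfolding n_def by (intro power_int_decreasing) auto
      finally have "M * L * \<epsilon> ^ n \<le> M * L * norm (\<epsilon> powi (N + 1))"
        using elim M(1) by (intro mult_left_mono) (auto simp: L_def)
      moreover have "0 < \<epsilon>" using elim by simp
      ultimately show ?case
        unfolding real_norm_def by (intro order_trans[OF bound])
    qed
    then show "(\<lambda>\<epsilon>. (\<integral>y. f y * \<psi> (b + \<epsilon> * y) \<partial>lborel) - (\<Sum>k\<in>{p..N}. \<eta> k * \<epsilon> powi k))
        \<in> O[at_right 0](\<lambda>\<epsilon>. \<epsilon> powi (N + 1))"
      by (rule bigoI)
  qed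
qed

section \<open>The shock profile\<close>

text \<open>For K = (1 + F)/2 and \<theta> = F'/2 the product (K - 1/2) \<theta> is F F'/4, which is
  x q \<open>gauss\<close>/8. With a = H_(2m)(0) this gives c = 1/(8a).\<close>

lemma shock_profile_exists:
  obtains \<theta> c where
    "schwartz \<theta>" "integral UNIV \<theta> = 1"
    "\<And>x. (Kfun \<theta> has_real_derivative \<theta> x) (at x)"
    "\<And>x. (Kfun \<theta> x - 1 / 2) * \<theta> x = c * (poly (hermite (Suc (2 * m))) x * gauss x)"
proof -
  define H where "H = hermite (Suc (2 * m))"
  define a where "a = poly (hermite (2 * m)) 0"
  have "a \<noteq> 0" unfolding a_def by (rule poly_hermite_even_0)
  obtain r where r: "H = pCons 0 r"
    using poly_hermite_odd_0[of m] unfolding H_def[symmetric] by (cases H) auto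
  \<comment> \<open>The factor 1/a normalises \<phi> = 1 - H_(2m) \<open>gauss\<close>/a to vanish
    at 0, and then \<phi>' = x q \<open>gauss\<close>.\<close>
  define q where "q = smult (1 / a) r"
  define \<phi> where "\<phi> x = 1 - 1 / a * (poly (hermite (2 * m)) x * gauss x)" for x
  have xq: "x * (poly q x * gauss x) = 1 / a * (poly H x * gauss x)" for x
    by (simp add: q_def r)
  have \<phi>': "(\<phi> has_real_derivative x * (poly q x * gauss x)) (at x)" for x
    using DERIV_diff[OF DERIV_const DERIV_cmult[OF has_derivative_hermite_gauss[of "2 * m" x], of "1 / a"], of 1]
    unfolding \<phi>_def[abs_def] xq H_def by simp
  have \<phi>0: "\<phi> 0 = 0"
    using \<open>a \<noteq> 0\<close> by (simp add: \<phi>_def a_def gauss_def)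
  have \<phi>_pos: "0 < \<phi> x" if "x \<noteq> 0" for x
  proof -
    define z where "z = 1 / a * (poly (hermite (2 * m)) x * gauss x)"
    have "z\<^sup>2 < 1"
      using hermite_gauss_less_initial[OF that, of m] \<open>a \<noteq> 0\<close>
      unfolding z_def power_mult_distrib[of "1 / a"] power_one_over
      by (simp add: a_def divide_simps)
    then have "z < 1" by (simp add: abs_square_less_1)
    then show ?thesis by (simp add: \<phi>_def z_def)
  qed
  \<comment> \<open>r(0) is the derivative of H at 0, that is (2m+1) a. Hence q(0) = 2m + 1,
    whatever the sign of a.\<close>
  have q0: "0 < poly q 0"
  proof -
    have "poly (pderiv H) 0 = poly r 0" by (simp add: r pderiv_pCons)
    then have "poly r 0 = real (Suc (2 * m)) * a"
      unfolding H_def pderiv_hermite a_def by simp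
    then show ?thesis using \<open>a \<noteq> 0\<close> by (simp add: q_def)
  qed
  have lim: "(\<phi> \<longlongrightarrow> 1) at_infinity"
    unfolding \<phi>_def
    using tendsto_diff[OF tendsto_const tendsto_mult[OF tendsto_const
          rapidly_decreasing_tendsto_0[OF rapidly_decreasing_poly_gauss]], of 1 "1 / a" "hermite (2 * m)"]
    by simp
  obtain F f where F: "\<And>x. (F has_real_derivative f x) (at x)"
    and f: "\<And>n. derivatives_satisfy rapidly_decreasing n f"
    and F2: "\<And>x. (F x)\<^sup>2 = \<phi> x" and F_pos: "\<And>x. 0 < x \<Longrightarrow> 0 < F x" and F_neg: "\<And>x. x < 0 \<Longrightarrow> F x < 0"
    and Ff: "\<And>x. F x * f x = x * (poly q x * gauss x) / 2"
    using smooth_square_root_at_double_zero[OF \<phi>' \<phi>0 \<phi>_pos q0 lim] by blast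
  \<comment> \<open>F has the sign of x, so it equals sqrt \<phi> on the right and -sqrt \<phi> on
    the left, which gives the limits 1 and -1.\<close>
  have sqrt: "((\<lambda>x. sqrt (\<phi> x)) \<longlongrightarrow> 1) at_infinity"
    using tendsto_real_sqrt[OF lim] by simp
  have F_top: "(F \<longlongrightarrow> 1) at_top"
  proof (rule Lim_transform_eventually)
    show "((\<lambda>x. sqrt (\<phi> x)) \<longlongrightarrow> 1) at_top"
      using sqrt by (rule tendsto_mono[OF at_top_le_at_infinity])
    show "\<forall>\<^sub>F x in at_top. sqrt (\<phi> x) = F x"
      using eventually_gt_at_top[of 0] by eventually_elim (use F_pos in \<open>simp add: F2[symmetric] less_imp_le\<close>)
  qed
  have F_bot: "(F \<longlongrightarrow> - 1) at_bot"
  proof (rule Lim_transform_eventually)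
    show "((\<lambda>x. - sqrt (\<phi> x)) \<longlongrightarrow> - 1) at_bot"
      using sqrt by (intro tendsto_minus tendsto_mono[OF at_bot_le_at_infinity])
    show "\<forall>\<^sub>F x in at_bot. - sqrt (\<phi> x) = F x"
      using eventually_gt_at_bot[of 0] by eventually_elim (use F_neg in \<open>simp add: F2[symmetric] less_imp_le\<close>)
  qed
  define \<theta> where "\<theta> x = 1 / 2 * f x" for x
  have \<theta>: "derivatives_satisfy rapidly_decreasing n \<theta>" for n
    unfolding \<theta>_def
    by (intro derivatives_rapidly_decreasing_mult derivatives_polynomially_bounded_const f)
  have cont: "continuous_on UNIV \<theta>"
    using \<theta>[of "Suc 0"] DERIV_isCont by (auto intro!: continuous_at_imp_continuous_on)
  have int: "integrable lborel \<theta>"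
    using \<theta>[of 0] cont by (auto intro: rapidly_decreasing_integrable)
  have G: "((\<lambda>x. 1 / 2 * F x) has_real_derivative \<theta> x) (at x)" for x
    unfolding \<theta>_def by (intro DERIV_cmult F)
  have G_bot: "((\<lambda>x. 1 / 2 * F x) \<longlongrightarrow> 1 / 2 * - 1) at_bot"
    by (intro tendsto_intros F_bot)
  have G_top: "((\<lambda>x. 1 / 2 * F x) \<longlongrightarrow> 1 / 2 * 1) at_top"
    by (intro tendsto_intros F_top)
  have K: "Kfun \<theta> x = 1 / 2 * F x + 1 / 2" for x
    unfolding Kfun_def using integral_atMost_FTC[OF G int G_bot] by simp
  show ?thesis
  proof (rule that[of \<theta> "1 / (8 * a)"])
    show "schwartz \<theta>" by (rule schwartzI[OF \<theta>])
    show "integral UNIV \<theta> = 1"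
      using integral_UNIV_FTC[OF G int G_bot G_top] integral_lborel[OF int] by simp
    show "(Kfun \<theta> has_real_derivative \<theta> x) (at x)" for x
      using DERIV_add[OF G DERIV_const] unfolding K[abs_def] by simp
    show "(Kfun \<theta> x - 1 / 2) * \<theta> x = 1 / (8 * a) * (poly (hermite (Suc (2 * m))) x * gauss x)" for x
    proof -
      have "(Kfun \<theta> x - 1 / 2) * \<theta> x = F x * f x / 4" by (simp add: K \<theta>_def)
      then show ?thesis by (simp add: Ff xq H_def)
    qed
  qed
qed

section \<open>The residual of the Hopf equation for this profile\<close>

theorem theorem3:
  fixes T :: real and p :: int
  assumes "T > 0"
  shows "\<exists>h0 dh a :: real. \<exists>\<theta> :: real \<Rightarrow> real.
           dh \<noteq> 0 \<and> schwartz \<theta> \<and> integral UNIV \<theta> = 1 \<and>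
           (a - h0) / dh = 1 / 2 \<and>
           (\<forall>t\<in>{0..T}. \<forall>\<psi>. schwartz \<psi> \<longrightarrow>
              eps_expansion_from
                (\<lambda>\<epsilon>. integral UNIV (\<lambda>x.
                   (deriv (\<lambda>s. shock_w \<theta> h0 dh a s x \<epsilon>) t
                    + shock_w \<theta> h0 dh a t x \<epsilon>
                      * deriv (\<lambda>y. shock_w \<theta> h0 dh a t y \<epsilon>) x) * \<psi> x))
                p)"
proof -
  \<comment> \<open>A natural k < p satisfies k < m < 2m + 1, so its moment vanishes; for p \<le> 0
    no moment condition arises.\<close>
  define m where "m = nat p"
  define H where "H = hermite (Suc (2 * m))"
  obtain \<theta> c where "schwartz \<theta>" "integral UNIV \<theta> = 1"
    and K: "\<And>x. (Kfun \<theta> has_real_derivative \<theta> x) (at x)"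
    and Kc: "\<And>x. (Kfun \<theta> x - 1 / 2) * \<theta> x = c * (poly H x * gauss x)"
    unfolding H_def using shock_profile_exists by blast
  have "eps_expansion_from
      (\<lambda>\<epsilon>. integral UNIV (\<lambda>x.
         (deriv (\<lambda>s. shock_w \<theta> 0 1 (1 / 2) s x \<epsilon>) t
          + shock_w \<theta> 0 1 (1 / 2) t x \<epsilon>
            * deriv (\<lambda>y. shock_w \<theta> 0 1 (1 / 2) t y \<epsilon>) x) * \<psi> x)) p"
    if \<psi>: "schwartz \<psi>" for t \<psi>
  proof -
    define f where "f y = c * (poly H y * gauss y)" for y
    have f_int: "integrable lborel (\<lambda>y. y ^ k * f y)" for k
      using integrable_mult_right[OF integrable_poly_gauss[of "monom 1 k * H"], of c]
      by (simp add: f_def poly_monom mult_ac)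
    have moments: "(\<integral>y. y ^ k * f y \<partial>lborel) = 0" if "int k < p" for k
    proof -
      have "(\<integral>y. y ^ k * f y \<partial>lborel) = c * (\<integral>y. y ^ k * (poly H y * gauss y) \<partial>lborel)"
        by (subst integral_mult_right_zero[symmetric]) (simp add: f_def mult_ac)
      also have "\<dots> = 0"
        unfolding H_def by (subst hermite_moment_0) (use that in \<open>auto simp: m_def\<close>)
      finally show ?thesis .
    qed
    show ?thesis
    \<comment> \<open>The base point t/2 is the shock position at time t; the substitution x = t/2 +
      \<epsilon> y leaves \<epsilon> only in the argument of \<psi>.\<close>
    proof (rule eps_expansion_from_cong[OF _ eps_expansion_of_moments[OF \<psi> f_int moments, where b = "t / 2"]])
      fix \<epsilon> :: real assume "0 < \<epsilon>"
      \<comment> \<open>With z = (x - t/2)/\<epsilon> the residual is (K(z) - 1/2)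
        \<theta>(z)/\<epsilon> = f(z)/\<epsilon>; the speed 1/2 supplies the -1/2. The Jacobian
        \<epsilon> later cancels the factor 1/\<epsilon>.\<close>
      define g where "g x = 1 / \<epsilon> * (f ((x - t / 2) / \<epsilon>) * \<psi> x)" for x
      have g: "g (t / 2 + \<epsilon> * y) = 1 / \<epsilon> * (f y * \<psi> (t / 2 + \<epsilon> * y))" for y
        using \<open>0 < \<epsilon>\<close> by (simp add: g_def)
      have "(deriv (\<lambda>s. shock_w \<theta> 0 1 (1 / 2) s x \<epsilon>) t
          + shock_w \<theta> 0 1 (1 / 2) t x \<epsilon>
            * deriv (\<lambda>y. shock_w \<theta> 0 1 (1 / 2) t y \<epsilon>) x) * \<psi> x = g x" for x
      proof -
        let ?z = "(x - t / 2) / \<epsilon>"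
        have "((\<lambda>s. Kfun \<theta> ((x - 1 / 2 * s) / \<epsilon>)) has_real_derivative
            \<theta> ((x - 1 / 2 * t) / \<epsilon>) * (- 1 / 2 / \<epsilon>)) (at t)"
          by (rule DERIV_chain2[OF K]) (use \<open>0 < \<epsilon>\<close> in \<open>auto intro!: derivative_eq_intros\<close>)
        then have 1: "deriv (\<lambda>s. shock_w \<theta> 0 1 (1 / 2) s x \<epsilon>) t = \<theta> ?z * (- 1 / 2 / \<epsilon>)"
          unfolding shock_w_def by (simp add: DERIV_imp_deriv)
        have "((\<lambda>y. Kfun \<theta> ((y - 1 / 2 * t) / \<epsilon>)) has_real_derivative
            \<theta> ((x - 1 / 2 * t) / \<epsilon>) * (1 / \<epsilon>)) (at x)"
          by (rule DERIV_chain2[OF K]) (use \<open>0 < \<epsilon>\<close> in \<open>auto intro!: derivative_eq_intros\<close>)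
        then have 2: "deriv (\<lambda>y. shock_w \<theta> 0 1 (1 / 2) t y \<epsilon>) x = \<theta> ?z * (1 / \<epsilon>)"
          unfolding shock_w_def by (simp add: DERIV_imp_deriv)
        have 3: "shock_w \<theta> 0 1 (1 / 2) t x \<epsilon> = Kfun \<theta> ?z"
          by (simp add: shock_w_def)
        show ?thesis
          unfolding 1 2 3 g_def f_def Kc[symmetric] by (simp add: algebra_simps)
      qed
      then have "integral UNIV (\<lambda>x. (deriv (\<lambda>s. shock_w \<theta> 0 1 (1 / 2) s x \<epsilon>) t
          + shock_w \<theta> 0 1 (1 / 2) t x \<epsilon>
            * deriv (\<lambda>y. shock_w \<theta> 0 1 (1 / 2) t y \<epsilon>) x) * \<psi> x) = integral UNIV g"
        by presburger
      also
      have "integrable lborel (\<lambda>y. g (t / 2 + \<epsilon> * y))"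
        unfolding g using integrable_mult_schwartz[OF \<psi>, of f] f_int[of 0] by simp
      then have "integrable lborel g"
        using \<open>0 < \<epsilon>\<close> by (simp add: lborel_integrable_real_affine_iff)
      then have "integral UNIV g = integral\<^sup>L lborel g"
        by (rule integral_lborel)
      also have "\<dots> = \<bar>\<epsilon>\<bar> *\<^sub>R (\<integral>y. g (t / 2 + \<epsilon> * y) \<partial>lborel)"
        using \<open>0 < \<epsilon>\<close> by (intro lborel_integral_real_affine) simp
      also have "\<dots> = (\<integral>y. f y * \<psi> (t / 2 + \<epsilon> * y) \<partial>lborel)"
        unfolding g using \<open>0 < \<epsilon>\<close> by simp
      finally show "integral UNIV (\<lambda>x. (deriv (\<lambda>s. shock_w \<theta> 0 1 (1 / 2) s x \<epsilon>) t
          + shock_w \<theta> 0 1 (1 / 2) t x \<epsilon>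
            * deriv (\<lambda>y. shock_w \<theta> 0 1 (1 / 2) t y \<epsilon>) x) * \<psi> x) =
          (\<integral>y. f y * \<psi> (t / 2 + \<epsilon> * y) \<partial>lborel)" .
    qed
  qed
  then show ?thesis
    using \<open>schwartz \<theta>\<close> \<open>integral UNIV \<theta> = 1\<close>
    by (intro exI[of _ 0] exI[of _ 1] exI[of _ "1 / 2"] exI[of _ \<theta>]) simp
qed

end
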